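(* Let $\mathcal{E}$ denote the family consisting of all paths, T-shape trees and H-shape trees. Let $T$ be a tree on $n$ vertices with $T\notin\mathcal{E}$. Then there exists $L_T\subseteq V(T)$ such that the graft $(T,L_T)$ contains a local complementation minor $(T',L_{T'})$ where $T'$ has at least three isolated vertices, none of which belongs to $L_{T'}$.
   Context: All graphs are finite, simple and undirected; $N_G(v)$ is the open neighbourhood of $v$ in $G$ and $\Delta$ denotes symmetric difference. A graft is a pair $(G,L_G)$ with $G$ a simple graph and $L_G\subseteq V(G)$. For $v\in V(G)$, the local complementation $G*v$ is the graph obtained from $G$ by toggling all adjacencies between distinct vertices of $N_G(v)$, and $G\underline{*}v:=(G*v)\setminus\{v\}$ (delete $v$ from $G*v$). For a graft $(G,L_G)$ and a vertex $v\in L_G$ (the operation is allowed only for such $v$), the local complementation deletion at $v$ is $$(G,L_G)\underline{*}v:=\bigl(G\underline{*}v,\,(L_G\setminus\{v\})\,\Delta\, N_G(v)\bigr).$$ A graft $(H,L_H)$ is a local complementation minor of $(G,L_G)$ if it can be obtained from $(G,L_G)$ by a sequence of local complementation deletions. The length of a path is its number of edges. For positive integers $a,b,c$, the T-shape tree $T(a,b,c)$ is obtained by attaching three pendant paths of lengths $a,b,c$ to a central vertex. For positive integers $a,b,c,d$, the H-shape tree $H(a,b,c,d)$ consists of two adjacent vertices of degree $3$, one incident with two pendant paths of lengths $a$ and $b$, and the other with two pendant paths of lengths $c$ and $d$. A T-shape tree (H-shape tree) is any graph isomorphic to some $T(a,b,c)$ (some $H(a,b,c,d)$). A path is a path graph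 $P_m$ on $m\ge1$ vertices. *)

theory Defs
  imports "Graph_Theory.Graph_Theory"
begin

text \<open>
  A finite simple undirected graph is a \<^locale>\<open>pair_graph\<close>: a finite loop-free digraph
  whose arc relation is symmetric, so that each edge is present as two opposite arcs.
\<close>

definition neighbourhood :: "'a pair_pre_digraph \<Rightarrow> 'a \<Rightarrow> 'a set" where
  "neighbourhood G v = {u. (v, u) \<in> parcs G}"

definition isolated_verts :: "'a pair_pre_digraph \<Rightarrow> 'a set" where
  "isolated_verts G = {v \<in> pverts G. neighbourhood G v = {}}"

text \<open>
  In a symmetric digraph the arcs \<open>(a, b), (b, a)\<close> already form a directed
  \<^const>\<open>pre_digraph.cycle\<close>, so the library's \<^const>\<open>tree\<close> fails for every symmetric
  graph with an edge. In a loop-free graph the cycles of the underlying undirected graph are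
  the directed ones of length at least 3.
\<close>

definition undirected_tree :: "'a pair_pre_digraph \<Rightarrow> bool" where
  "undirected_tree G \<longleftrightarrow>
     pair_graph G \<and> connected (with_proj G) \<and>
     \<not> (\<exists>p. pre_digraph.cycle (with_proj G) p \<and> 3 \<le> length p)"


subsection \<open>Grafts and local complementation minors\<close>

type_synonym 'a graft = "'a pair_pre_digraph \<times> 'a set"

definition local_complement :: "'a pair_pre_digraph \<Rightarrow> 'a \<Rightarrow> 'a pair_pre_digraph" where
  "local_complement G v =
     \<lparr> pverts = pverts G,
       parcs = sym_diff (parcs G)
         {(x, y). x \<in> neighbourhood G v \<and> y \<in> neighbourhood G v \<and> x \<noteq> y} \<rparr>"

definition delete_vert :: "'a pair_pre_digraph \<Rightarrow> 'a \<Rightarrow> 'a pair_pre_digraph" where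
  "delete_vert G v =
     \<lparr> pverts = pverts G - {v}, parcs = {(x, y) \<in> parcs G. x \<noteq> v \<and> y \<noteq> v} \<rparr>"

definition lc_deletion :: "'a graft \<Rightarrow> 'a \<Rightarrow> 'a graft" where
  "lc_deletion = (\<lambda>(G, L) v.
     (delete_vert (local_complement G v) v, sym_diff (L - {v}) (neighbourhood G v)))"

lemma pair_graphI:
  assumes "finite (pverts G)" "parcs G \<subseteq> pverts G \<times> pverts G" "sym (parcs G)" "irrefl (parcs G)"
  shows "pair_graph G"
proof -
  have "finite (parcs G)" using assms(1,2) finite_subset by blast
  then show ?thesis using assms
    by unfold_locales (auto simp: symmetric_def irrefl_def)
qed

lemma pair_graph_lc_deletion:
  assumes "pair_graph G" and "L \<subseteq> pverts G" and "v \<in> L"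
    and "lc_deletion (G, L) v = (H, M)"
  shows "pair_graph H \<and> M \<subseteq> pverts H"
proof -
  interpret pair_graph G by fact
  have "pair_graph H"
    using assms(4)
    by (intro pair_graphI) (auto simp: lc_deletion_def delete_vert_def local_complement_def
       neighbourhood_def sym_def irrefl_def dest: in_arcsD1 in_arcsD2 arcs_symmetric no_loops')
  moreover have "M \<subseteq> pverts H"
    using assms by (auto simp: lc_deletion_def delete_vert_def local_complement_def
       neighbourhood_def dest: in_arcsD1 in_arcsD2 no_loops')
  ultimately show ?thesis by simp
qed

inductive lc_minor :: "'a graft \<Rightarrow> 'a graft \<Rightarrow> bool" for \<G> :: "'a graft" where
  refl: "lc_minor \<G> \<G>"
| step: "lc_minor \<G> \<H> \<Longrightarrow> v \<in> snd \<H> \<Longrightarrow> lc_minor \<G> (lc_deletion \<H> v)"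


subsection \<open>Paths, T-shape trees and H-shape trees\<close>

definition sym_closure :: "'a rel \<Rightarrow> 'a rel" where
  "sym_closure R = R \<union> converse R"

definition path_graph :: "nat \<Rightarrow> nat pair_pre_digraph" where
  "path_graph m =
     \<lparr> pverts = {..<m}, parcs = sym_closure {(i, Suc i) | i. Suc i < m} \<rparr>"

text \<open>
  \<open>Arm i 0, \<dots>, Arm i (k - 1)\<close> are the vertices of the \<open>i\<close>-th pendant path, of length \<open>k\<close>,
  listed starting from the neighbour of the branch vertex to which the path is attached.
\<close>

datatype vertex = Centre nat | Arm nat nat

definition arm_verts :: "nat \<Rightarrow> nat \<Rightarrow> vertex set" where
  "arm_verts i k = {Arm i j | j. j < k}"

definition arm_arcs :: "vertex \<Rightarrow> nat \<Rightarrow> nat \<Rightarrow> vertex rel" where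
  "arm_arcs c i k =
     {(c, Arm i 0)} \<union> {(Arm i j, Arm i (Suc j)) | j. Suc j < k}"

definition T_shape :: "nat \<Rightarrow> nat \<Rightarrow> nat \<Rightarrow> vertex pair_pre_digraph" where
  "T_shape a b c =
     \<lparr> pverts = {Centre 0} \<union> arm_verts 0 a \<union> arm_verts 1 b \<union> arm_verts 2 c,
       parcs = sym_closure
         (arm_arcs (Centre 0) 0 a \<union> arm_arcs (Centre 0) 1 b \<union> arm_arcs (Centre 0) 2 c) \<rparr>"

definition H_shape :: "nat \<Rightarrow> nat \<Rightarrow> nat \<Rightarrow> nat \<Rightarrow> vertex pair_pre_digraph" where
  "H_shape a b c d =
     \<lparr> pverts = {Centre 0, Centre 1} \<union>
         arm_verts 0 a \<union> arm_verts 1 b \<union> arm_verts 2 c \<union> arm_verts 3 d,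
       parcs = sym_closure
         ({(Centre 0, Centre 1)} \<union>
          arm_arcs (Centre 0) 0 a \<union> arm_arcs (Centre 0) 1 b \<union>
          arm_arcs (Centre 1) 2 c \<union> arm_arcs (Centre 1) 3 d) \<rparr>"

definition is_path :: "'a pair_pre_digraph \<Rightarrow> bool" where
  "is_path G \<longleftrightarrow> (\<exists>m\<ge>1. digraph_iso (with_proj (path_graph m)) (with_proj G))"

definition is_T_shape :: "'a pair_pre_digraph \<Rightarrow> bool" where
  "is_T_shape G \<longleftrightarrow>
     (\<exists>a\<ge>1. \<exists>b\<ge>1. \<exists>c\<ge>1. digraph_iso (with_proj (T_shape a b c)) (with_proj G))"

definition is_H_shape :: "'a pair_pre_digraph \<Rightarrow> bool" where
  "is_H_shape G \<longleftrightarrow>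
     (\<exists>a\<ge>1. \<exists>b\<ge>1. \<exists>c\<ge>1. \<exists>d\<ge>1.
        digraph_iso (with_proj (H_shape a b c d)) (with_proj G))"

definition path_T_H_family :: "'a pair_pre_digraph set" where
  "path_T_H_family = {G. is_path G \<or> is_T_shape G \<or> is_H_shape G}"

lemma digraph_iso_pair_graph_iff:
  assumes "pair_graph G"
  shows "digraph_iso (with_proj G) (with_proj H) \<longleftrightarrow>
    (\<exists>f. inj_on f (pverts G) \<and> pverts H = f ` pverts G \<and>
         parcs H = (\<lambda>(x, y). (f x, f y)) ` parcs G)" (is "?L \<longleftrightarrow> ?R")
proof
  interpret pair_graph G by fact
  assume ?L
  then obtain h where h: "pre_digraph.digraph_isomorphism (with_proj G) h"
      and H: "with_proj H = app_iso h (with_proj G)"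
    unfolding digraph_iso_def by blast
  let ?f = "iso_verts h"
  have t: "iso_tail h = fst" "iso_head h = snd" "pverts H = ?f ` pverts G"
      "parcs H = iso_arcs h ` parcs G"
    using H by (auto simp: with_proj_def app_iso_def)
  have "iso_arcs h e = (?f (fst e), ?f (snd e))" if "e \<in> parcs G" for e
    using h that by (auto simp: pre_digraph.digraph_isomorphism_def t prod_eq_iff)
  then have "parcs H = (\<lambda>(x, y). (?f x, ?f y)) ` parcs G"
    by (simp add: t case_prod_unfold)
  then show ?R using h t by (auto simp: pre_digraph.digraph_isomorphism_def)
next
  interpret pair_graph G by fact
  assume ?R
  then obtain f where f: "inj_on f (pverts G)" "pverts H = f ` pverts G"
      "parcs H = (\<lambda>(x, y). (f x, f y)) ` parcs G" by blast
  let ?h = "\<lparr> iso_verts = f, iso_arcs = (\<lambda>(x, y). (f x, f y)), iso_head = snd, iso_tail = fst \<rparr>"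
  have "inj_on (\<lambda>(x, y). (f x, f y)) (parcs G)"
    using f(1) by (auto simp: inj_on_def dest: in_arcsD1 in_arcsD2)
  then have "pre_digraph.digraph_isomorphism (with_proj G) ?h"
    using f(1) wf_digraph_axioms by (auto simp: pre_digraph.digraph_isomorphism_def)
  moreover have "with_proj H = app_iso ?h (with_proj G)"
    using f by (simp add: with_proj_def app_iso_def)
  ultimately show ?L unfolding digraph_iso_def by blast
qed

end

theory Submission
  imports Defs
begin

text \<open>
  The label set is ours to choose, and this removes the labels from the problem: every
  sequence of local complementation deletions, at whatever vertices, is legal for a
  suitable initial label set that ends up empty (\<open>isolates_imp_lc_minor\<close>). What remains is to
  transform the unlabelled tree by such deletions into a graph with three isolated vertices.

  Deleting a leaf changes nothing else, so a tree may first be pruned to any subtree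
  (\<open>isolates_connected_superset\<close>). Two kinds of subtree suffice. A star with \<open>k + 1\<close> leaves
  yields \<open>k\<close> isolated vertices: delete the centre, which produces a clique, and then one vertex
  of the clique (\<open>isolates_star\<close>). This settles trees with a vertex of degree at least 4. If
  \<open>u\<close> and \<open>v\<close> are nonadjacent vertices of degree at least 3, keep two neighbours \<open>a\<close>, \<open>b\<close> of \<open>u\<close>
  as leaves together with the component of \<open>T - u\<close> that contains \<open>v\<close>. Deleting \<open>u\<close> and \<open>a\<close>
  isolates \<open>b\<close> and leaves that component intact, and the star around \<open>v\<close> gives two more
  isolated vertices (\<open>isolates_two_nonadjacent_branch_verts\<close>).

  A tree with neither of these two features is a path, a T-shape or an H-shape: grow
  the tree leaf by leaf and observe that a leaf attached to one of these shapes either gives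
  such a shape again or creates one of the two features (\<open>list_shape_add_leaf\<close>,
  \<open>list_shape_or_crowded\<close>).
\<close>

section \<open>Deletion sequences without labels\<close>

definition lc_delete :: "'a pair_pre_digraph \<Rightarrow> 'a \<Rightarrow> 'a pair_pre_digraph" where
  "lc_delete G v = delete_vert (local_complement G v) v"

lemma pverts_lc_delete [simp]: "pverts (lc_delete G v) = pverts G - {v}"
  by (simp add: lc_delete_def delete_vert_def local_complement_def)

lemma arc_lc_delete_iff:
  "(x, y) \<in> parcs (lc_delete G v) \<longleftrightarrow>
     x \<noteq> v \<and> y \<noteq> v \<and> ((x, y) \<in> parcs G \<longleftrightarrow> \<not> ((v, x) \<in> parcs G \<and> (v, y) \<in> parcs G \<and> x \<noteq> y))"
  by (auto simp: lc_delete_def delete_vert_def local_complement_def neighbourhood_def)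

lemma graph_eqI:
  fixes G H :: "'a pair_pre_digraph"
  assumes "pverts G = pverts H" and "\<And>x y. (x, y) \<in> parcs G \<longleftrightarrow> (x, y) \<in> parcs H"
  shows "G = H"
  using assms by (intro pair_pre_digraph.equality) auto

lemma pair_graph_lc_delete:
  assumes "pair_graph G" and "v \<in> pverts G"
  shows "pair_graph (lc_delete G v)"
  using pair_graph_lc_deletion[OF assms(1), of "{v}" v] assms(2)
  by (simp add: lc_deletion_def lc_delete_def)

text \<open>
  The vertices deleted here are arbitrary. The labels of a graft come in again only when a
  deletion sequence is turned into a local complementation minor.
\<close>

inductive isolates :: "nat \<Rightarrow> 'a pair_pre_digraph \<Rightarrow> bool" for k where
  enough: "k \<le> card (isolated_verts G) \<Longrightarrow> isolates k G"
| delete: "v \<in> pverts G \<Longrightarrow> isolates k (lc_delete G v) \<Longrightarrow> isolates k G"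

lemma lc_minor_prepend:
  assumes "lc_minor (lc_deletion \<G> v) \<H>" and "v \<in> snd \<G>"
  shows "lc_minor \<G> \<H>"
  using assms(1)
proof (induction rule: lc_minor.induct)
  case refl
  show ?case
    using lc_minor.step[OF lc_minor.refl assms(2)] .
next
  case (step \<H> w)
  then show ?case
    by (intro lc_minor.step)
qed

text \<open>
  The labels never obstruct a deletion sequence, because the initial label set is at our
  disposal. If the sequence starts with \<open>v\<close> and the remaining graph needs the labels \<open>L\<close>, then
  \<open>{v} \<union> (L \<Delta> N(v))\<close> is a label set that allows the deletion of \<open>v\<close> and turns into \<open>L\<close>.
  Starting from no labels at the end of the sequence, this determines all labels backwards.
\<close>

lemma isolates_imp_lc_minor:
  assumes "isolates k G" and "pair_graph G"
  shows "\<exists>L \<subseteq> pverts G. \<exists>H M. lc_minor (G, L) (H, M) \<and>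
           k \<le> card (isolated_verts H) \<and> isolated_verts H \<inter> M = {}"
  using assms
proof (induction rule: isolates.induct)
  case (enough G)
  then show ?case
    using lc_minor.refl[of "(G, {})"] by blast
next
  case (delete v G)
  interpret pair_graph G by fact
  from delete obtain L H M where L: "L \<subseteq> pverts G - {v}" and
    minor: "lc_minor (lc_delete G v, L) (H, M)"
    and isolated: "k \<le> card (isolated_verts H)" "isolated_verts H \<inter> M = {}"
    using delete.IH[OF pair_graph_lc_delete[OF \<open>pair_graph G\<close> delete.hyps(1)]]
    unfolding pverts_lc_delete by blast
  define K where "K = insert v (sym_diff L (neighbourhood G v))"
  have "v \<notin> neighbourhood G v" "neighbourhood G v \<subseteq> pverts G"
    by (auto simp: neighbourhood_def dest: in_arcsD2 no_loops')
  then have K: "K \<subseteq> pverts G" and "sym_diff (K - {v}) (neighbourhood G v) = L"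
    using L delete.hyps(1) by (auto simp: K_def)
  then have "lc_deletion (G, K) v = (lc_delete G v, L)"
    by (simp add: lc_deletion_def lc_delete_def)
  then have "lc_minor (G, K) (H, M)"
    using lc_minor_prepend[of "(G, K)" v] minor by (simp add: K_def)
  then show ?case using K isolated by blast
qed

definition add_isolated :: "'a \<Rightarrow> 'a pair_pre_digraph \<Rightarrow> 'a pair_pre_digraph" where
  "add_isolated b G = \<lparr> pverts = insert b (pverts G), parcs = parcs G \<rparr>"

text \<open>
  An isolated vertex is not affected by deletions at other vertices, so it can be set aside
  and counted at the end.
\<close>

lemma isolates_add_isolated:
  assumes "isolates k G" and "pair_graph G" and "b \<notin> pverts G"
  shows "isolates (Suc k) (add_isolated b G)"
  using assms
proof (induction rule: isolates.induct)
  case (enough G)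
  interpret pair_graph G by fact
  have "isolated_verts (add_isolated b G) = insert b (isolated_verts G)"
    using enough by (auto simp: isolated_verts_def add_isolated_def neighbourhood_def dest: in_arcsD1)
  moreover have "finite (isolated_verts G)" "b \<notin> isolated_verts G"
    using enough.prems by (auto simp: isolated_verts_def)
  ultimately show ?case
    using enough.hyps by (intro isolates.enough) simp
next
  case (delete v G)
  have "lc_delete (add_isolated b G) v = add_isolated b (lc_delete G v)"
    using delete.hyps(1) delete.prems(2)
    by (intro graph_eqI) (auto simp: add_isolated_def arc_lc_delete_iff)
  moreover have "isolates (Suc k) (add_isolated b (lc_delete G v))"
    using delete.IH[OF pair_graph_lc_delete[OF delete.prems(1) delete.hyps(1)]] delete.prems(2)
    by simp
  moreover have "v \<in> pverts (add_isolated b G)"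
    using delete.hyps(1) by (simp add: add_isolated_def)
  ultimately show ?case
    using isolates.delete[of v "add_isolated b G"] by simp
qed

definition induced :: "'a pair_pre_digraph \<Rightarrow> 'a set \<Rightarrow> 'a pair_pre_digraph" where
  "induced G S = \<lparr> pverts = S, parcs = parcs G \<inter> S \<times> S \<rparr>"

lemma induced_simps [simp]:
  "pverts (induced G S) = S" "parcs (induced G S) = parcs G \<inter> S \<times> S"
  by (simp_all add: induced_def)

text \<open>
  Let \<open>u\<close> carry two pendant vertices \<open>a\<close>, \<open>b\<close> and one further neighbour \<open>p\<close>. Deleting \<open>u\<close>
  makes \<open>a\<close>, \<open>b\<close>, \<open>p\<close> a triangle; deleting \<open>a\<close> then removes the edge between \<open>b\<close> and \<open>p\<close>.
  The branch at \<open>u\<close> is thus traded for the isolated vertex \<open>b\<close>, and the rest is untouched.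
\<close>

lemma lc_delete_pendant_pair:
  assumes "pair_graph G"
    and u: "\<And>w. (u, w) \<in> parcs G \<longleftrightarrow> w = a \<or> w = b \<or> w = p"
    and a: "\<And>w. (a, w) \<in> parcs G \<longleftrightarrow> w = u"
    and b: "\<And>w. (b, w) \<in> parcs G \<longleftrightarrow> w = u"
    and distinct: "distinct [u, a, b, p]" and "b \<in> pverts G"
  shows "lc_delete (lc_delete G u) a = add_isolated b (induced G (pverts G - {u, a, b}))"
    (is "?L = ?R")
proof (rule graph_eqI)
  interpret pair_graph G by fact
  have sym: "(x, y) \<in> parcs G \<longleftrightarrow> (y, x) \<in> parcs G" for x y
    using arcs_symmetric by blast
  show "pverts ?L = pverts ?R"
    using distinct \<open>b \<in> pverts G\<close> by (auto simp: add_isolated_def)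
  have ends: "(x, u) \<in> parcs G \<longleftrightarrow> x = a \<or> x = b \<or> x = p" "(x, a) \<in> parcs G \<longleftrightarrow> x = u" "(x, b) \<in> parcs G \<longleftrightarrow> x = u" for x
    using sym[of x u] sym[of x a] sym[of x b] u[of x] a[of x] b[of x] by simp_all
  have H: "(x, y) \<in> parcs (lc_delete G u) \<longleftrightarrow>
      x \<noteq> u \<and> y \<noteq> u \<and> ((x, y) \<in> parcs G \<longleftrightarrow> \<not> (x \<in> {a, b, p} \<and> y \<in> {a, b, p} \<and> x \<noteq> y))" for x y
    by (simp add: arc_lc_delete_iff u)
  have aH: "(a, y) \<in> parcs (lc_delete G u) \<longleftrightarrow> y = b \<or> y = p" for y
    using distinct by (auto simp: H a)
  have L: "(x, y) \<in> parcs ?L \<longleftrightarrow> x \<noteq> a \<and> y \<noteq> a \<and>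
      ((x, y) \<in> parcs (lc_delete G u) \<longleftrightarrow> \<not> (x \<in> {b, p} \<and> y \<in> {b, p} \<and> x \<noteq> y))" for x y
    by (simp add: arc_lc_delete_iff[of _ _ _ a] aH)
  show "(x, y) \<in> parcs ?L \<longleftrightarrow> (x, y) \<in> parcs ?R" for x y
  proof (cases "x \<in> {u, a, b} \<or> y \<in> {u, a, b}")
    case True
    then have "(x, y) \<notin> parcs ?L"
      using distinct by (elim disjE insertE emptyE) (simp_all add: L H ends a b, blast+)
    moreover have "(x, y) \<notin> parcs ?R"
      using True by (auto simp: add_isolated_def)
    ultimately show ?thesis by simp
  next
    case False
    then have "(x, y) \<in> parcs ?L \<longleftrightarrow> (x, y) \<in> parcs G"
      by (auto simp: L H)
    also have "\<dots> \<longleftrightarrow> (x, y) \<in> parcs ?R"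
      using False by (auto simp: add_isolated_def dest: in_arcsD1 in_arcsD2)
    finally show ?thesis .
  qed
qed

section \<open>Connected vertex sets of a tree\<close>

locale tree_graph =
  fixes T :: "'a pair_pre_digraph"
  assumes tree: "undirected_tree T"
begin

sublocale pair_graph T
  using tree by (simp add: undirected_tree_def)

definition connected_set :: "'a set \<Rightarrow> bool" where
  "connected_set S \<longleftrightarrow>
     S \<subseteq> pverts T \<and> (\<forall>x\<in>S. \<forall>y\<in>S. (x, y) \<in> (parcs (induced T S))\<^sup>*)"

lemma arc_sym: "(x, y) \<in> parcs T \<longleftrightarrow> (y, x) \<in> parcs T"
  using arcs_symmetric by blast

lemma no_loop [simp]: "(x, x) \<notin> parcs T"
  using no_loops' by blast

lemma pair_graph_induced:
  assumes "S \<subseteq> pverts T"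
  shows "pair_graph (induced T S)"
  using assms finite_subset[OF assms pair_finite_verts]
  by (intro pair_graphI) (auto simp: sym_def irrefl_def arc_sym)

lemma connected_set_pverts: "connected_set (pverts T)" and pverts_nonempty: "pverts T \<noteq> {}"
proof -
  have "connected (with_proj T)"
    using tree by (simp add: undirected_tree_def)
  then have "pverts T \<noteq> {}"
    and reach: "\<forall>u\<in>pverts T. \<forall>v\<in>pverts T. reachable (with_proj (mk_symmetric T)) u v"
    by (auto simp: connected_def strongly_connected_def)
  then show "pverts T \<noteq> {}" by simp
  have "(u, v) \<in> (parcs T)\<^sup>*" if "u \<in> pverts T" "v \<in> pverts T" for u v
    using reach that reachable_rtranclI[of "with_proj T" u v]
    by (simp add: reachable_mk_symmetric_eq[OF sym_arcs])
  moreover have "parcs T \<inter> pverts T \<times> pverts T = parcs T"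
    by (auto dest: in_arcsD1 in_arcsD2)
  ultimately show "connected_set (pverts T)"
    by (simp add: connected_set_def)
qed

lemma connected_set_path:
  assumes "connected_set S" and "y \<in> S" and "z \<in> S"
  obtains p where "awalk y p z" "distinct (pawalk_verts y p)" "set (pawalk_verts y p) \<subseteq> S"
proof -
  interpret S: pair_graph "induced T S"
    using assms by (intro pair_graph_induced) (simp add: connected_set_def)
  have "reachable (with_proj (induced T S)) y z"
    using assms by (auto simp: connected_set_def S.reachable_conv)
  then obtain p where "S.apath y p z"
    using S.reachable_apath by auto
  then have p: "S.awalk y p z" "distinct (pawalk_verts y p)"
    by (auto simp: S.apath_def)
  have "set (pawalk_verts y p) \<subseteq> pverts (induced T S)" "set p \<subseteq> parcs (induced T S)" "pcas y p z"
    using p(1) unfolding S.awalk_conv by blast+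
  moreover have "S \<subseteq> pverts T" using assms by (simp add: connected_set_def)
  ultimately show thesis
    using p(2) by (intro that[of p]) (auto simp: awalk_def \<open>y \<in> S\<close> subsetD)
qed

text \<open>
  Otherwise a path in \<open>S\<close> between the two neighbours closes up to a cycle through \<open>x\<close>. Later
  arguments use the acyclicity of \<open>T\<close> only in this form.
\<close>

lemma unique_neighbour_in_connected_set:
  assumes "connected_set S" and "x \<notin> S" and "y \<in> S" and "z \<in> S"
    and "(x, y) \<in> parcs T" and "(x, z) \<in> parcs T"
  shows "y = z"
proof (rule ccontr)
  assume "y \<noteq> z"
  obtain p where p: "awalk y p z" "distinct (pawalk_verts y p)" "set (pawalk_verts y p) \<subseteq> S"
    using connected_set_path assms by blast
  define c where "c = (x, y) # p @ [(z, x)]"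
  have zx: "(z, x) \<in> parcs T" using assms arc_sym by blast
  then have "awalk z [(z, x)] x"
    by (auto simp: awalk_simps dest: in_arcsD2)
  then have walk: "awalk y (p @ [(z, x)]) x"
    using p(1) awalk_appendI by blast
  then have "pawalk_verts y (p @ [(z, x)]) = pawalk_verts y p @ [x]"
    using awalk_verts_append[OF walk] by simp
  then have "distinct (tl (pawalk_verts x c))"
    using p assms(2) by (auto simp: c_def)
  moreover have "awalk x c x"
    using walk p(1) assms by (simp add: c_def awalk_simps)
  ultimately have "pre_digraph.cycle (with_proj T) c"
    unfolding cycle_def by (auto simp: c_def)
  moreover have "p \<noteq> []" using p(1) \<open>y \<noteq> z\<close> by (auto simp: awalk_simps)
  then have "3 \<le> length c" by (cases p) (auto simp: c_def)
  ultimately show False using tree by (auto simp: undirected_tree_def)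
qed

lemma connected_set_singleton: "x \<in> pverts T \<Longrightarrow> connected_set {x}"
  by (simp add: connected_set_def)

lemma connected_set_insert:
  assumes "connected_set S" and "y \<in> S" and "(y, x) \<in> parcs T"
  shows "connected_set (insert x S)"
proof -
  let ?R = "(parcs (induced T (insert x S)))\<^sup>*"
  have "(u, v) \<in> ?R" if "u \<in> S" "v \<in> S" for u v
    using assms(1) that rtrancl_mono[of "parcs (induced T S)" "parcs (induced T (insert x S))"]
    by (auto simp: connected_set_def)
  moreover have "(y, x) \<in> ?R" "(x, y) \<in> ?R"
    using assms arc_sym by auto
  ultimately have "(u, v) \<in> ?R" if "u \<in> insert x S" "v \<in> insert x S" for u v
    using that \<open>y \<in> S\<close> by (metis insertE rtrancl.rtrancl_refl rtrancl_trans)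
  then show ?thesis
    using assms in_arcsD2 by (auto simp: connected_set_def)
qed

lemma connected_set_add_neighbours:
  assumes "connected_set S" and "y \<in> S" and "finite A" and "\<And>a. a \<in> A \<Longrightarrow> (y, a) \<in> parcs T"
  shows "connected_set (A \<union> S)"
  using assms(3,4)
proof (induction rule: finite_induct)
  case (insert a A)
  then show ?case
    using connected_set_insert[of "A \<union> S" y a] \<open>y \<in> S\<close> by simp
qed (simp add: assms(1))

lemma neighbours_nonadjacent:
  assumes "(c, x) \<in> parcs T" and "(c, y) \<in> parcs T"
  shows "(x, y) \<notin> parcs T"
proof
  assume "(x, y) \<in> parcs T"
  moreover have "connected_set {x, c}"
    using assms arc_sym in_arcsD1 by (intro connected_set_insert[OF connected_set_singleton]) auto
  moreover have "y \<noteq> c" "y \<noteq> x" "(y, c) \<in> parcs T" "(y, x) \<in> parcs T"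
    using \<open>(x, y) \<in> parcs T\<close> assms arc_sym by auto
  ultimately have "c = x"
    using unique_neighbour_in_connected_set[of "{x, c}" y c x] by simp
  then show False using assms(1) by simp
qed

text \<open>
  A connected set \<open>A\<close> reaches any connected set \<open>B \<supseteq> A\<close> by adding one adjacent vertex at a
  time. By \<open>unique_neighbour_in_connected_set\<close> each added vertex is a leaf of the new subtree, so this
  is induction on trees by adding leaves, started from an arbitrary subtree.
\<close>

lemma connected_set_grow [consumes 4, case_names start leaf]:
  assumes "connected_set A" and "A \<noteq> {}" and "connected_set B" and "A \<subseteq> B"
    and "P A"
    and leaf: "\<And>S x y. \<lbrakk>connected_set S; S \<subseteq> B; x \<in> B; x \<notin> S; y \<in> S; (x, y) \<in> parcs T; P S\<rbrakk>
      \<Longrightarrow> P (insert x S)"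
  shows "P B"
  using assms(1,2,4,5)
proof (induction "card (B - A)" arbitrary: A rule: less_induct)
  case less
  show ?case
  proof (cases "A = B")
    case False
    then obtain a b where "a \<in> A" "b \<in> B" "b \<notin> A"
      using less.prems by blast
    have "(a, b) \<in> (parcs (induced T B))\<^sup>*"
      using assms(3) less.prems \<open>a \<in> A\<close> \<open>b \<in> B\<close> by (auto simp: connected_set_def)
    then have "\<exists>y x. y \<in> A \<and> x \<notin> A \<and> (y, x) \<in> parcs (induced T B)"
      using \<open>a \<in> A\<close> \<open>b \<notin> A\<close> by (induction rule: rtrancl_induct) blast+
    then obtain y x where yx: "y \<in> A" "x \<notin> A" "x \<in> B" "(y, x) \<in> parcs T"
      by auto
    have "finite B"
      using assms(3) finite_subset[OF _ pair_finite_verts] by (simp add: connected_set_def)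
    then have "card (B - insert x A) < card (B - A)"
      using yx by (intro psubset_card_mono) auto
    moreover have "connected_set (insert x A)"
      using less.prems yx connected_set_insert by blast
    moreover have "P (insert x A)"
      using leaf less.prems yx arc_sym by blast
    ultimately show ?thesis
      using less yx by blast
  qed (use less in simp)
qed

section \<open>Isolating vertices in trees\<close>

text \<open>
  Growing backwards: local complementation at a leaf changes no edge, so deleting leaves
  prunes a tree down to any subtree.
\<close>

lemma isolates_connected_superset:
  assumes "connected_set A" and "A \<noteq> {}" and "connected_set B" and "A \<subseteq> B"
    and "isolates k (induced T A)"
  shows "isolates k (induced T B)"
  using assms
proof (induction rule: connected_set_grow)
  case (leaf S x y)
  have "z = y" if "(x, z) \<in> parcs T" "z \<in> S" for z
    using unique_neighbour_in_connected_set leaf that by blast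
  then have "lc_delete (induced T (insert x S)) x = induced T S"
    using leaf by (intro graph_eqI) (auto simp: arc_lc_delete_iff)
  then show ?case
    using leaf isolates.delete[of x "induced T (insert x S)"] by simp
qed

text \<open>
  It is enough to treat the star formed by \<open>c\<close> and its \<open>k + 1\<close> neighbours in \<open>A\<close>. Deleting the
  centre makes \<open>A\<close> a clique, and deleting one vertex of a clique leaves the others without
  edges.
\<close>

lemma isolates_star:
  assumes "connected_set B" and "c \<in> B" and "finite A" and "card A = Suc k"
    and "A \<subseteq> B \<inter> neighbourhood T c"
  shows "isolates k (induced T B)"
proof -
  obtain a where "a \<in> A" using assms(4) by fastforce
  have A: "(c, x) \<in> parcs T" "(x, c) \<in> parcs T" "x \<noteq> c" if "x \<in> A" for x
    using assms(5) that arc_sym by (auto simp: neighbourhood_def)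
  have nonadjacent: "(x, y) \<notin> parcs T" if "x \<in> A" "y \<in> A" for x y
    using neighbours_nonadjacent A that by blast
  let ?S = "A \<union> {c}"
  have "lc_delete (lc_delete (induced T ?S) c) a = \<lparr> pverts = A - {a}, parcs = {} \<rparr>"
    using A nonadjacent \<open>a \<in> A\<close> by (intro graph_eqI) (auto simp: arc_lc_delete_iff)
  moreover have "isolated_verts \<lparr> pverts = A - {a}, parcs = {} \<rparr> = A - {a}"
    by (auto simp: isolated_verts_def neighbourhood_def)
  then have "isolates k \<lparr> pverts = A - {a}, parcs = {} \<rparr>"
    using assms(4) \<open>a \<in> A\<close> by (intro isolates.enough) simp
  ultimately have "isolates k (induced T ?S)"
    using A \<open>a \<in> A\<close> isolates.delete[of c "induced T ?S" k]
      isolates.delete[of a "lc_delete (induced T ?S) c" k] by simp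
  moreover have "connected_set ?S"
    using connected_set_add_neighbours[OF connected_set_singleton] assms A
    by (auto simp: connected_set_def)
  ultimately show ?thesis
    using isolates_connected_superset[of ?S B] assms by auto
qed

text \<open>
  The branch vertex \<open>u\<close> is used up to produce one isolated vertex. Since \<open>u\<close> and \<open>v\<close> are not
  adjacent, the component of \<open>v\<close> in \<open>T - u\<close> still contains all neighbours of \<open>v\<close>, so the star
  around \<open>v\<close> provides the two others.
\<close>

lemma isolates_two_nonadjacent_branch_verts:
  assumes "u \<in> pverts T" and "v \<in> pverts T" and "u \<noteq> v" and "(u, v) \<notin> parcs T"
    and "3 \<le> card (neighbourhood T u)" and "3 \<le> card (neighbourhood T v)"
  shows "isolates 3 T"
proof -
  have fin: "finite (neighbourhood T w)" for w
    by (rule finite_subset[OF _ pair_finite_verts]) (auto simp: neighbourhood_def dest: in_arcsD2)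
  \<comment> \<open>\<open>C\<close> is the component of \<open>v\<close> in \<open>T - u\<close>.\<close>
  define E where "E = parcs (induced T (pverts T - {u}))"
  define C where "C = {w. (v, w) \<in> E\<^sup>*}"
  have "sym E" by (auto simp: E_def sym_def arc_sym)
  have "w \<in> pverts T - {u}" if "(v, w) \<in> E\<^sup>*" for w
    using that assms by (induction rule: rtrancl_induct) (auto simp: E_def)
  then have "C \<subseteq> pverts T" "u \<notin> C" by (auto simp: C_def)
  have "v \<in> C" by (simp add: C_def)
  have closed: "y \<in> C" if "x \<in> C" "(x, y) \<in> parcs T" "y \<noteq> u" for x y
    using that \<open>C \<subseteq> pverts T\<close> \<open>u \<notin> C\<close> in_arcsD2[of x y]
    by (auto simp: C_def E_def intro!: rtrancl_into_rtrancl[of v x _ y])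
  have "(v, w) \<in> (parcs (induced T C))\<^sup>*" if "(v, w) \<in> E\<^sup>*" for w
    using that
  proof (induction rule: rtrancl_induct)
    case (step y z)
    then have "y \<in> C" "z \<in> C" by (auto simp: C_def)
    then show ?case
      using step by (intro rtrancl_into_rtrancl[of v y _ z]) (auto simp: E_def)
  qed simp
  moreover have "sym (parcs (induced T C))" by (auto simp: sym_def arc_sym)
  ultimately have "connected_set C"
    using \<open>C \<subseteq> pverts T\<close> unfolding connected_set_def C_def
    by (auto intro: rtrancl_trans dest: sym_rtrancl[THEN symD])
  have one_in_C: "y = z" if "y \<in> C" "z \<in> C" "(u, y) \<in> parcs T" "(u, z) \<in> parcs T" for y z
    using unique_neighbour_in_connected_set \<open>connected_set C\<close> \<open>u \<notin> C\<close> that by blast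
  \<comment> \<open>\<open>p\<close> is the first vertex on the way from \<open>u\<close> to \<open>v\<close>.\<close>
  obtain p where p: "p \<in> C" "(u, p) \<in> parcs T"
  proof -
    have "\<exists>y x. y \<in> C \<and> x \<notin> C \<and> (y, x) \<in> parcs (induced T (pverts T))"
    proof -
      have "(v, u) \<in> (parcs (induced T (pverts T)))\<^sup>*"
        using connected_set_pverts assms by (auto simp: connected_set_def)
      then show ?thesis using \<open>u \<notin> C\<close> \<open>v \<in> C\<close>
        by (induction rule: rtrancl_induct) blast+
    qed
    then obtain y x where "y \<in> C" "x \<notin> C" "(y, x) \<in> parcs T" by auto
    then show thesis using that closed arc_sym[of y u] by metis
  qed
  have "2 \<le> card (neighbourhood T u - {p})"
    using assms(5) p(2) by (simp add: neighbourhood_def)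
  then obtain A where "A \<subseteq> neighbourhood T u - {p}" "card A = 2"
    using obtain_subset_with_card_n by metis
  then obtain a b where "a \<noteq> b" and ab: "(u, a) \<in> parcs T" "(u, b) \<in> parcs T" "a \<noteq> p" "b \<noteq> p"
    by (auto simp: card_2_iff neighbourhood_def)
  have notin: "a \<notin> C" "b \<notin> C" "a \<noteq> u" "b \<noteq> u"
    using one_in_C p ab by auto
  have no_arcs: "(a, w) \<notin> parcs T" "(w, a) \<notin> parcs T" "(b, w) \<notin> parcs T" "(w, b) \<notin> parcs T"
    if "w \<in> C" for w
    using that closed notin arc_sym[of a] arc_sym[of b] by metis+
  have "(a, b) \<notin> parcs T" "(b, a) \<notin> parcs T"
    using neighbours_nonadjacent ab by blast+
  \<comment> \<open>In the subtree \<open>S\<close>, the vertex \<open>u\<close> has degree 3 and \<open>a\<close>, \<open>b\<close> are leaves.\<close>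
  define S where "S = {a, b} \<union> insert u C"
  have "connected_set S"
    unfolding S_def using connected_set_insert[OF \<open>connected_set C\<close> p(1)] p(2) arc_sym[of p u] ab
    by (intro connected_set_add_neighbours[of _ u]) auto
  have u_arcs: "(u, w) \<in> parcs T \<longleftrightarrow> w = p" "(w, u) \<in> parcs T \<longleftrightarrow> w = p" if "w \<in> C" for w
    using that one_in_C p arc_sym[of w u] by auto
  have "lc_delete (lc_delete (induced T S) u) a =
      add_isolated b (induced (induced T S) (pverts (induced T S) - {u, a, b}))"
  proof (rule lc_delete_pendant_pair[where p = p])
    show "pair_graph (induced T S)"
      using \<open>connected_set S\<close> by (simp add: connected_set_def pair_graph_induced)
    show "(u, w) \<in> parcs (induced T S) \<longleftrightarrow> w = a \<or> w = b \<or> w = p" for w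
      using ab p u_arcs by (auto simp: S_def)
    have "(a, u) \<in> parcs T" "(b, u) \<in> parcs T"
      using ab arc_sym by auto
    then show "(a, w) \<in> parcs (induced T S) \<longleftrightarrow> w = u" "(b, w) \<in> parcs (induced T S) \<longleftrightarrow> w = u" for w
      using \<open>(a, b) \<notin> parcs T\<close> \<open>(b, a) \<notin> parcs T\<close> no_arcs by (auto simp: S_def)
    show "distinct [u, a, b, p]" "b \<in> pverts (induced T S)"
      using notin ab p(1) \<open>a \<noteq> b\<close> \<open>u \<notin> C\<close> by (auto simp: S_def)
  qed
  moreover have "induced (induced T S) (pverts (induced T S) - {u, a, b}) = induced T C"
    using notin \<open>u \<notin> C\<close> by (intro graph_eqI) (auto simp: S_def)
  moreover have "isolates 3 (add_isolated b (induced T C))"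
  proof -
    have "neighbourhood T v \<subseteq> C"
      using closed \<open>v \<in> C\<close> assms(4) arc_sym[of u v] by (auto simp: neighbourhood_def)
    moreover obtain B where "B \<subseteq> neighbourhood T v" "card B = Suc 2" "finite B"
      using obtain_subset_with_card_n[OF assms(6)] fin by auto
    ultimately have "isolates 2 (induced T C)"
      using isolates_star \<open>connected_set C\<close> \<open>v \<in> C\<close> by blast
    then show ?thesis
      using isolates_add_isolated[of 2 "induced T C" b] pair_graph_induced \<open>C \<subseteq> pverts T\<close> notin
      by simp
  qed
  ultimately have "isolates 3 (induced T S)"
    using notin isolates.delete[of u "induced T S" 3]
      isolates.delete[of a "lc_delete (induced T S) u" 3] by (simp add: S_def)
  moreover have "induced T (pverts T) = T"
    by (intro graph_eqI) (auto dest: in_arcsD1 in_arcsD2)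
  ultimately show ?thesis
    using isolates_connected_superset[of S "pverts T"] connected_set_pverts
      \<open>connected_set S\<close> by (auto simp: connected_set_def S_def)
qed

end

section \<open>Paths, T-shapes and H-shapes given by lists of vertices\<close>

text \<open>
  Lists of vertices make it easy to cut a path at a vertex and to extend it at its end, which
  is all that is needed to follow the shape of a tree while leaves are added.
\<close>

fun steps :: "'a list \<Rightarrow> 'a rel" where
  "steps (x # y # zs) = insert (x, y) (steps (y # zs))"
| "steps _ = {}"

lemma steps_conv_nth: "steps xs = {(xs ! i, xs ! Suc i) | i. Suc i < length xs}"
proof (induction xs rule: steps.induct)
  case (1 x y zs)
  show ?case (is "_ = ?R")
  proof (intro equalityI subsetI)
    fix e assume "e \<in> ?R"
    then obtain i where "e = ((x # y # zs) ! i, (y # zs) ! i)" "i < length (y # zs)"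
      by auto
    then show "e \<in> steps (x # y # zs)"
      by (cases i) (auto simp: 1)
  next
    fix e assume "e \<in> steps (x # y # zs)"
    then consider "e = (x, y)" | i where "e = ((y # zs) ! i, zs ! i)" "i < length zs"
      by (auto simp: 1)
    then show "e \<in> ?R"
    proof cases
      case 1
      then show ?thesis by (intro CollectI exI[of _ 0]) simp
    next
      case 2
      then show ?thesis by (intro CollectI exI[of _ "Suc i"]) simp
    qed
  qed
qed auto

lemma steps_append: "steps (xs @ y # ys) = steps (xs @ [y]) \<union> steps (y # ys)"
  by (induction xs rule: steps.induct) auto

lemma steps_snoc: "steps (xs @ [x, y]) = insert (x, y) (steps (xs @ [x]))"
  by (subst steps_append) auto

lemma steps_rev: "steps (rev xs) = converse (steps xs)"
  by (induction xs rule: steps.induct) (auto simp: steps_snoc)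

lemma steps_subset: "steps xs \<subseteq> set xs \<times> set xs"
  by (induction xs rule: steps.induct) auto

lemma not_in_steps: "x \<notin> set xs \<or> y \<notin> set xs \<Longrightarrow> (x, y) \<notin> steps xs"
  using subsetD[OF steps_subset, of "(x, y)" xs] by auto

lemma sym_closure_Un: "sym_closure (R \<union> S) = sym_closure R \<union> sym_closure S"
  and sym_closure_converse: "sym_closure (converse R) = sym_closure R"
  and sym_closure_insert: "sym_closure (insert (x, y) R) = {(x, y), (y, x)} \<union> sym_closure R"
  and sym_closure_empty: "sym_closure {} = {}"
  by (auto simp: sym_closure_def)

lemmas sym_closure_simps = sym_closure_Un sym_closure_converse sym_closure_insert sym_closure_empty

definition line :: "'a list \<Rightarrow> 'a pair_pre_digraph" where
  "line xs = \<lparr> pverts = set xs, parcs = sym_closure (steps xs) \<rparr>"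

definition fork :: "'a \<Rightarrow> 'a list \<Rightarrow> 'a list \<Rightarrow> 'a list \<Rightarrow> 'a pair_pre_digraph" where
  "fork c xs ys zs =
     \<lparr> pverts = set (c # xs @ ys @ zs),
       parcs = sym_closure (steps (c # xs) \<union> steps (c # ys) \<union> steps (c # zs)) \<rparr>"

definition twin_fork ::
  "'a \<Rightarrow> 'a list \<Rightarrow> 'a list \<Rightarrow> 'a \<Rightarrow> 'a list \<Rightarrow> 'a list \<Rightarrow> 'a pair_pre_digraph" where
  "twin_fork c xs ys d zs ws =
     \<lparr> pverts = set (c # d # xs @ ys @ zs @ ws),
       parcs = sym_closure ({(c, d)} \<union> steps (c # xs) \<union> steps (c # ys) \<union>
         steps (d # zs) \<union> steps (d # ws)) \<rparr>"

inductive list_shape :: "'a pair_pre_digraph \<Rightarrow> bool" where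
  line: "\<lbrakk>xs \<noteq> []; distinct xs\<rbrakk> \<Longrightarrow> list_shape (line xs)"
| fork: "\<lbrakk>xs \<noteq> []; ys \<noteq> []; zs \<noteq> []; distinct (c # xs @ ys @ zs)\<rbrakk> \<Longrightarrow>
    list_shape (fork c xs ys zs)"
| twin_fork: "\<lbrakk>xs \<noteq> []; ys \<noteq> []; zs \<noteq> []; ws \<noteq> []; distinct (c # d # xs @ ys @ zs @ ws)\<rbrakk> \<Longrightarrow>
    list_shape (twin_fork c xs ys d zs ws)"

text \<open>
  The degree conditions that rule out the three shapes. In a tree of maximum degree 3 that is
  not crowded, the branch vertices are pairwise adjacent; as there is no triangle, there are
  at most two of them.
\<close>

definition crowded :: "'a pair_pre_digraph \<Rightarrow> bool" where
  "crowded G \<longleftrightarrow>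
     (\<exists>c \<in> pverts G. 4 \<le> card (neighbourhood G c)) \<or>
     (\<exists>u \<in> pverts G. \<exists>v \<in> pverts G. u \<noteq> v \<and> (u, v) \<notin> parcs G \<and>
        3 \<le> card (neighbourhood G u) \<and> 3 \<le> card (neighbourhood G v))"

lemma length_le_card_neighbourhood:
  assumes "distinct ws" and "set ws \<subseteq> neighbourhood G v" and "finite (parcs G)"
  shows "length ws \<le> card (neighbourhood G v)"
proof -
  have "neighbourhood G v \<subseteq> snd ` parcs G" by (force simp: neighbourhood_def)
  then have "finite (neighbourhood G v)" using assms(3) finite_surj by blast
  then show ?thesis using card_mono[OF _ assms(2)] distinct_card[OF assms(1)] by simp
qed

lemma crowdedI_degree_4:
  assumes "distinct ws" and "length ws = 4" and "set ws \<subseteq> neighbourhood G c"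
    and "c \<in> pverts G" and "finite (parcs G)"
  shows "crowded G"
  using assms length_le_card_neighbourhood[of ws G c] by (auto simp: crowded_def)

lemma crowdedI_nonadjacent:
  assumes "distinct us" and "length us = 3" and "set us \<subseteq> neighbourhood G u"
    and "distinct vs" and "length vs = 3" and "set vs \<subseteq> neighbourhood G v"
    and "u \<in> pverts G" and "v \<in> pverts G" and "u \<noteq> v" and "(u, v) \<notin> parcs G" and "finite (parcs G)"
  shows "crowded G"
  using assms length_le_card_neighbourhood[of us G u] length_le_card_neighbourhood[of vs G v]
  unfolding crowded_def by (intro disjI2 bexI[of _ u] bexI[of _ v]) simp_all

definition add_leaf :: "'a pair_pre_digraph \<Rightarrow> 'a \<Rightarrow> 'a \<Rightarrow> 'a pair_pre_digraph" where
  "add_leaf G y v = \<lparr> pverts = insert v (pverts G), parcs = {(y, v), (v, y)} \<union> parcs G \<rparr>"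

lemma finite_steps: "finite (steps xs)"
  by (rule finite_subset[OF steps_subset]) simp

lemma finite_parcs_add_leaf:
  "finite (parcs (add_leaf (fork c xs ys zs) y v))"
  "finite (parcs (add_leaf (twin_fork c xs ys d zs ws) y v))"
  by (simp_all add: add_leaf_def fork_def twin_fork_def sym_closure_def finite_steps)

text \<open>
  At an end of the path the leaf extends it; at an inner vertex it creates a T-shape.
\<close>

lemma add_leaf_line:
  assumes "distinct xs" and "y \<in> set xs" and "v \<notin> set xs"
  shows "list_shape (add_leaf (line xs) y v)"
proof -
  obtain as bs where xs: "xs = as @ y # bs" using assms(2) by (meson split_list)
  consider "bs = []" | "as = []" | "as \<noteq> []" "bs \<noteq> []" by blast
  then show ?thesis
  proof cases
    case 1
    then have "add_leaf (line xs) y v = line (xs @ [v])"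
      by (auto simp: xs add_leaf_def line_def steps_snoc sym_closure_simps)
    then show ?thesis using assms by (simp add: list_shape.line)
  next
    case 2
    then have "add_leaf (line xs) y v = line (v # xs)"
      by (auto simp: xs add_leaf_def line_def sym_closure_simps)
    then show ?thesis using assms by (simp add: list_shape.line)
  next
    case 3
    have "steps (y # rev as) = converse (steps (as @ [y]))"
      using steps_rev[of "as @ [y]"] by simp
    then have "add_leaf (line xs) y v = fork y (rev as) bs [v]"
      by (auto simp: xs add_leaf_def line_def fork_def steps_append[of as y bs] sym_closure_simps)
    then show ?thesis
      using 3 assms by (auto simp: xs intro!: list_shape.fork)
  qed
qed

lemma add_leaf_fork_centre:
  assumes "xs \<noteq> []" and "ys \<noteq> []" and "zs \<noteq> []" and "distinct (c # xs @ ys @ zs)"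
    and "v \<notin> set (c # xs @ ys @ zs)"
  shows "crowded (add_leaf (fork c xs ys zs) c v)"
proof -
  obtain x xs' y ys' z zs' where [simp]: "xs = x # xs'" "ys = y # ys'" "zs = z # zs'"
    using assms by (auto simp: neq_Nil_conv)
  show ?thesis
    using assms
    by (intro crowdedI_degree_4[of "[x, y, z, v]" _ c] finite_parcs_add_leaf)
      (auto simp: neighbourhood_def add_leaf_def fork_def sym_closure_simps)
qed

text \<open>
  The leaf extends the arm at its end. At a vertex next to the centre it creates a second
  branch vertex adjacent to the first, hence an H-shape. Further out, the new branch
  vertex is not adjacent to the centre.
\<close>

lemma add_leaf_fork_arm:
  assumes "xs \<noteq> []" and "ys \<noteq> []" and "zs \<noteq> []" and "distinct (c # xs @ ys @ zs)"
    and "y \<in> set xs" and "v \<notin> set (c # xs @ ys @ zs)"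
  shows "list_shape (add_leaf (fork c xs ys zs) y v) \<or> crowded (add_leaf (fork c xs ys zs) y v)"
proof -
  obtain as bs where xs: "xs = as @ y # bs" using assms(5) by (meson split_list)
  obtain s ys' t zs' where [simp]: "ys = s # ys'" "zs = t # zs'"
    using assms by (auto simp: neq_Nil_conv)
  consider "bs = []" | "as = []" "bs \<noteq> []" | as' p q bs' where "as = as' @ [p]" "bs = q # bs'"
    by (cases as rule: rev_cases; cases bs) auto
  then show ?thesis
  proof cases
    case 1
    then have "add_leaf (fork c xs ys zs) y v = fork c (xs @ [v]) ys zs"
      using steps_snoc[of "c # as" y v]
      by (auto simp: xs add_leaf_def fork_def sym_closure_simps)
    moreover have "list_shape (fork c (xs @ [v]) ys zs)"
      using assms by (intro list_shape.fork) auto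
    ultimately show ?thesis by simp
  next
    case 2
    then have "add_leaf (fork c xs ys zs) y v = twin_fork c ys zs y bs [v]"
      by (auto simp: xs add_leaf_def fork_def twin_fork_def sym_closure_simps)
    moreover have "list_shape (twin_fork c ys zs y bs [v])"
      using assms 2 by (intro list_shape.twin_fork) (auto simp: xs)
    ultimately show ?thesis by simp
  next
    case 3
    have arm: "steps (c # xs) = steps (c # as' @ [p]) \<union> {(p, y), (y, q)} \<union> steps (q # bs')"
      using steps_append[of "c # as'" p "y # q # bs'"] by (auto simp: xs 3)
    obtain x where x: "(c, x) \<in> steps (c # xs)" "x \<in> set xs"
      using assms(1) by (cases xs) auto
    have "crowded (add_leaf (fork c xs ys zs) y v)"
    proof (rule crowdedI_nonadjacent[of "[p, q, v]" _ y "[x, s, t]" c])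
      show "set [p, q, v] \<subseteq> neighbourhood (add_leaf (fork c xs ys zs) y v) y"
        by (auto simp: neighbourhood_def add_leaf_def fork_def arm sym_closure_simps)
      show "set [x, s, t] \<subseteq> neighbourhood (add_leaf (fork c xs ys zs) y v) c"
        using x(1) by (auto simp: neighbourhood_def add_leaf_def fork_def sym_closure_def)
      show "(y, c) \<notin> parcs (add_leaf (fork c xs ys zs) y v)"
      proof -
        have "y \<notin> set (c # as' @ [p])" "c \<notin> set (q # bs')" "y \<notin> set (c # ys)" "y \<notin> set (c # zs)"
          "c \<noteq> y" "c \<noteq> p" "c \<noteq> q" "c \<noteq> v"
          using assms(4,6) by (auto simp: xs 3)
        then show ?thesis
          by (simp del: steps.simps add: add_leaf_def fork_def arm sym_closure_def not_in_steps)
      qed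
      show "distinct [p, q, v]" "distinct [x, s, t]" "y \<noteq> c"
        using assms(4,6) x(2) by (auto simp: xs 3)
    qed (simp_all add: finite_parcs_add_leaf, simp_all add: add_leaf_def fork_def xs)
    then show ?thesis by simp
  qed
qed

lemma fork_permute: "fork c ys xs zs = fork c xs ys zs" "fork c zs xs ys = fork c xs ys zs"
  by (auto simp: fork_def Un_ac)

lemma add_leaf_fork:
  assumes ne: "xs \<noteq> []" "ys \<noteq> []" "zs \<noteq> []" and dist: "distinct (c # xs @ ys @ zs)"
    and "y \<in> set (c # xs @ ys @ zs)" and v: "v \<notin> set (c # xs @ ys @ zs)"
  shows "list_shape (add_leaf (fork c xs ys zs) y v) \<or> crowded (add_leaf (fork c xs ys zs) y v)"
proof -
  consider "y = c" | "y \<in> set xs" | "y \<in> set ys" | "y \<in> set zs" using assms(5) by auto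
  then show ?thesis
  proof cases
    case 1
    then show ?thesis using add_leaf_fork_centre[OF ne dist v] by simp
  next
    case 2
    then show ?thesis using add_leaf_fork_arm[OF ne dist _ v] by simp
  next
    case 3
    moreover have "distinct (c # ys @ xs @ zs)" "v \<notin> set (c # ys @ xs @ zs)"
      using dist v by auto
    ultimately show ?thesis
      using add_leaf_fork_arm[of ys xs zs c y v] ne
      unfolding fork_permute(1)[of c ys xs zs] by blast
  next
    case 4
    moreover have "distinct (c # zs @ xs @ ys)" "v \<notin> set (c # zs @ xs @ ys)"
      using dist v by auto
    ultimately show ?thesis
      using add_leaf_fork_arm[of zs xs ys c y v] ne
      unfolding fork_permute(2)[of c zs xs ys] by blast
  qed
qed

lemma add_leaf_twin_fork_centre:
  assumes "xs \<noteq> []" and "ys \<noteq> []" and "distinct (c # d # xs @ ys @ zs @ ws)"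
    and "v \<notin> set (c # d # xs @ ys @ zs @ ws)"
  shows "crowded (add_leaf (twin_fork c xs ys d zs ws) c v)"
proof -
  obtain x xs' y ys' where [simp]: "xs = x # xs'" "ys = y # ys'"
    using assms by (auto simp: neq_Nil_conv)
  show ?thesis
    using assms
    by (intro crowdedI_degree_4[of "[x, y, d, v]" _ c] finite_parcs_add_leaf)
      (auto simp: neighbourhood_def add_leaf_def twin_fork_def sym_closure_simps)
qed

text \<open>
  Unless the leaf extends the arm, it makes \<open>y\<close> a third branch vertex. It may be adjacent to
  \<open>c\<close>, but never to the other centre \<open>d\<close>.
\<close>

lemma add_leaf_twin_fork_arm:
  assumes "xs \<noteq> []" and "ys \<noteq> []" and "zs \<noteq> []" and "ws \<noteq> []"
    and "distinct (c # d # xs @ ys @ zs @ ws)"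
    and "y \<in> set xs" and "v \<notin> set (c # d # xs @ ys @ zs @ ws)"
  shows "list_shape (add_leaf (twin_fork c xs ys d zs ws) y v) \<or>
         crowded (add_leaf (twin_fork c xs ys d zs ws) y v)"
proof -
  obtain as bs where xs: "xs = as @ y # bs" using assms(6) by (meson split_list)
  obtain s zs' t ws' where [simp]: "zs = s # zs'" "ws = t # ws'"
    using assms by (auto simp: neq_Nil_conv)
  \<comment> \<open>\<open>p\<close> precedes \<open>y\<close> on the arm; it is \<open>c\<close> if \<open>y\<close> is the first vertex of the arm.\<close>
  obtain as' p where p: "c # as = as' @ [p]" by (metis list.discI rev_exhaust)
  show ?thesis
  proof (cases bs)
    case Nil
    then have "add_leaf (twin_fork c xs ys d zs ws) y v = twin_fork c (xs @ [v]) ys d zs ws"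
      using steps_snoc[of "c # as" y v]
      by (auto simp: xs add_leaf_def twin_fork_def sym_closure_simps)
    moreover have "list_shape (twin_fork c (xs @ [v]) ys d zs ws)"
      using assms by (intro list_shape.twin_fork) auto
    ultimately show ?thesis by simp
  next
    case (Cons q bs')
    have "steps (c # xs) = steps ((c # as) @ y # bs)" by (simp add: xs)
    also have "\<dots> = steps (as' @ [p, y]) \<union> steps (y # bs)"
      by (subst steps_append) (simp add: p)
    finally have arcs: "(p, y) \<in> steps (c # xs)" "(y, q) \<in> steps (c # xs)"
      by (auto simp: steps_snoc Cons)
    have "p \<in> set (c # as)" by (simp add: p)
    have "crowded (add_leaf (twin_fork c xs ys d zs ws) y v)"
    proof (rule crowdedI_nonadjacent[of "[p, q, v]" _ y "[c, s, t]" d])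
      show "set [p, q, v] \<subseteq> neighbourhood (add_leaf (twin_fork c xs ys d zs ws) y v) y"
        using arcs by (auto simp: neighbourhood_def add_leaf_def twin_fork_def sym_closure_def)
      show "set [c, s, t] \<subseteq> neighbourhood (add_leaf (twin_fork c xs ys d zs ws) y v) d"
        by (auto simp: neighbourhood_def add_leaf_def twin_fork_def sym_closure_simps)
      show "(y, d) \<notin> parcs (add_leaf (twin_fork c xs ys d zs ws) y v)"
      proof -
        have "d \<notin> set (c # xs)" "y \<notin> set (c # ys)" "y \<notin> set (d # zs)" "y \<notin> set (d # ws)"
          "c \<noteq> d" "c \<noteq> y" "d \<noteq> y" "d \<noteq> v"
          using assms(5-7) by auto
        then show ?thesis
          by (simp del: steps.simps add: add_leaf_def twin_fork_def sym_closure_def not_in_steps)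
      qed
      show "distinct [p, q, v]" "distinct [c, s, t]" "y \<noteq> d"
        using assms(5,7) \<open>p \<in> set (c # as)\<close> by (auto simp: xs Cons)
    qed (simp_all add: finite_parcs_add_leaf, simp_all add: add_leaf_def twin_fork_def xs)
    then show ?thesis by simp
  qed
qed

lemma twin_fork_swap_arms: "twin_fork c ys xs d zs ws = twin_fork c xs ys d zs ws"
  and twin_fork_swap_centres: "twin_fork d zs ws c xs ys = twin_fork c xs ys d zs ws"
  by (auto simp: twin_fork_def sym_closure_simps Un_ac)

lemma add_leaf_twin_fork:
  assumes ne: "xs \<noteq> []" "ys \<noteq> []" "zs \<noteq> []" "ws \<noteq> []"
    and dist: "distinct (c # d # xs @ ys @ zs @ ws)"
    and "y \<in> set (c # d # xs @ ys @ zs @ ws)" and v: "v \<notin> set (c # d # xs @ ys @ zs @ ws)"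
  shows "list_shape (add_leaf (twin_fork c xs ys d zs ws) y v) \<or>
         crowded (add_leaf (twin_fork c xs ys d zs ws) y v)"
proof -
  have half: "list_shape (add_leaf (twin_fork c xs ys d zs ws) y v) \<or>
         crowded (add_leaf (twin_fork c xs ys d zs ws) y v)"
    if hyps: "xs \<noteq> []" "ys \<noteq> []" "zs \<noteq> []" "ws \<noteq> []" "distinct (c # d # xs @ ys @ zs @ ws)"
      "y \<in> set (c # xs @ ys)" "v \<notin> set (c # d # xs @ ys @ zs @ ws)"
    for c xs ys d zs ws
  proof -
    consider "y = c" | "y \<in> set xs" | "y \<in> set ys" using hyps by auto
    then show ?thesis
    proof cases
      case 1
      then show ?thesis using add_leaf_twin_fork_centre hyps by metis
    next
      case 2
      then show ?thesis using add_leaf_twin_fork_arm hyps by metis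
    next
      case 3
      have "distinct (c # d # ys @ xs @ zs @ ws)" "v \<notin> set (c # d # ys @ xs @ zs @ ws)"
        using hyps by auto
      then show ?thesis
        using add_leaf_twin_fork_arm[of ys xs zs ws c d y v] hyps 3
        unfolding twin_fork_swap_arms[of c ys xs d zs ws] by blast
    qed
  qed
  show ?thesis
  proof (cases "y \<in> set (c # xs @ ys)")
    case True
    then show ?thesis using half ne dist v by blast
  next
    case False
    then have "y \<in> set (d # zs @ ws)" using assms(6) by auto
    moreover have "distinct (d # c # zs @ ws @ xs @ ys)" "v \<notin> set (d # c # zs @ ws @ xs @ ys)"
      using dist v by auto
    ultimately show ?thesis
      using half[of zs ws xs ys d c] ne
      unfolding twin_fork_swap_centres[of d zs ws c xs ys] by auto
  qed
qed

lemma list_shape_add_leaf: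
  assumes "list_shape G" and "y \<in> pverts G" and "v \<notin> pverts G"
  shows "list_shape (add_leaf G y v) \<or> crowded (add_leaf G y v)"
  using assms
proof (cases rule: list_shape.cases)
  case (line xs)
  then show ?thesis using add_leaf_line[of xs y v] assms by (simp add: line_def)
next
  case (fork xs ys zs c)
  then show ?thesis using add_leaf_fork[of xs ys zs c y v] assms by (simp add: fork_def)
next
  case (twin_fork xs ys zs ws c d)
  then show ?thesis
    using add_leaf_twin_fork[of xs ys zs ws c d y v] assms by (simp add: twin_fork_def)
qed

section \<open>Isomorphisms to the standard path, T-shape and H-shape trees\<close>

text \<open>
  Injectivity is obtained by counting: \<open>f\<close> maps at most \<open>length us\<close> vertices onto that many.
  This avoids comparing the arms of a T-shape or H-shape pairwise.
\<close>

lemma digraph_iso_mk_graph: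
  assumes "pair_graph G" and "G = \<lparr> pverts = V, parcs = sym_closure R \<rparr>"
    and "f ` V = set us" and "distinct us" and "card V \<le> length us"
    and "(\<lambda>(x, y). (f x, f y)) ` R = S"
  shows "digraph_iso (with_proj G) (with_proj \<lparr> pverts = set us, parcs = sym_closure S \<rparr>)"
proof -
  interpret pair_graph G by fact
  have "finite V" using pair_finite_verts assms(2) by simp
  moreover have "card (f ` V) = card V"
    using assms(3-5) card_image_le[OF \<open>finite V\<close>, of f] distinct_card[of us] by simp
  ultimately have "inj_on f V" by (rule eq_card_imp_inj_on)
  moreover have "sym_closure S = (\<lambda>(x, y). (f x, f y)) ` sym_closure R"
    unfolding assms(6)[symmetric] sym_closure_def by force
  ultimately show ?thesis
    unfolding digraph_iso_pair_graph_iff[OF assms(1)] using assms(2,3)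
    by (intro exI[of _ f]) simp
qed

lemma pair_graph_sym_closure:
  assumes "finite V" and "R \<subseteq> V \<times> V" and "irrefl R"
  shows "pair_graph \<lparr> pverts = V, parcs = sym_closure R \<rparr>"
  using assms by (intro pair_graphI) (auto simp: sym_closure_def sym_def irrefl_def)

lemma arm_verts_conv_image: "arm_verts i k = Arm i ` {..<k}"
  by (auto simp: arm_verts_def)

lemma finite_arm_verts: "finite (arm_verts i k)" and card_arm_verts: "card (arm_verts i k) = k"
  by (simp_all add: arm_verts_conv_image card_image inj_on_def)

lemma arm_arcs_subset: "1 \<le> k \<Longrightarrow> arm_arcs c i k \<subseteq> insert c (arm_verts i k) \<times> arm_verts i k"
  and irrefl_arm_arcs: "irrefl (arm_arcs (Centre j) i k)"
  by (auto simp: arm_arcs_def arm_verts_def irrefl_def)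

lemma image_arm_verts:
  assumes "\<And>j. f (Arm i j) = xs ! j"
  shows "f ` arm_verts i (length xs) = set xs"
  by (auto simp: arm_verts_conv_image image_image assms set_conv_nth)

lemma image_arm_arcs:
  assumes "\<And>j. f (Arm i j) = xs ! j" and "xs \<noteq> []"
  shows "(\<lambda>(x, y). (f x, f y)) ` arm_arcs c i (length xs) = steps (f c # xs)"
proof -
  have "steps (f c # xs) = insert (f c, xs ! 0) (steps xs)"
    using assms(2) by (cases xs) auto
  also have "\<dots> = (\<lambda>(x, y). (f x, f y)) ` arm_arcs c i (length xs)"
  proof -
    have "{(Arm i j, Arm i (Suc j)) | j. Suc j < length xs} =
        (\<lambda>j. (Arm i j, Arm i (Suc j))) ` {j. Suc j < length xs}"
      and "steps xs = (\<lambda>j. (xs ! j, xs ! Suc j)) ` {j. Suc j < length xs}"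
      by (auto simp: steps_conv_nth)
    then show ?thesis
      by (simp add: arm_arcs_def image_Un image_image assms(1))
  qed
  finally show ?thesis by simp
qed

lemma is_path_line:
  assumes "xs \<noteq> []" and "distinct xs"
  shows "is_path (line xs)"
proof -
  let ?m = "length xs"
  have "{(i, Suc i) | i. Suc i < ?m} = (\<lambda>i. (i, Suc i)) ` {i. Suc i < ?m}"
    and "steps xs = (\<lambda>i. (xs ! i, xs ! Suc i)) ` {i. Suc i < ?m}"
    by (auto simp: steps_conv_nth)
  then have "(\<lambda>(x, y). (xs ! x, xs ! y)) ` {(i, Suc i) | i. Suc i < ?m} = steps xs"
    by (simp add: image_image)
  moreover have "(\<lambda>i. xs ! i) ` {..<?m} = set xs"
    by (auto simp: set_conv_nth)
  moreover have "pair_graph (path_graph ?m)"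
    unfolding path_graph_def by (intro pair_graph_sym_closure) (auto simp: irrefl_def)
  ultimately have "digraph_iso (with_proj (path_graph ?m)) (with_proj (line xs))"
    unfolding line_def using assms(2)
    by (intro digraph_iso_mk_graph[OF _ path_graph_def, where f = "\<lambda>i. xs ! i"]) auto
  moreover have "1 \<le> ?m" using assms(1) by (cases xs) auto
  ultimately show ?thesis unfolding is_path_def by blast
qed

lemma is_T_shape_fork:
  assumes "xs \<noteq> []" and "ys \<noteq> []" and "zs \<noteq> []" and "distinct (c # xs @ ys @ zs)"
  shows "is_T_shape (fork c xs ys zs)"
proof -
  define a b k where lengths: "a = length xs" "b = length ys" "k = length zs"
  have pos: "1 \<le> a" "1 \<le> b" "1 \<le> k"
    using assms by (simp_all add: lengths Suc_le_eq)
  define f where "f v = (case v of Centre _ \<Rightarrow> c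
    | Arm i j \<Rightarrow> (if i = 0 then xs else if i = 1 then ys else zs) ! j)" for v
  have f: "f (Centre 0) = c" "f (Arm 0 j) = xs ! j" "f (Arm 1 j) = ys ! j" "f (Arm 2 j) = zs ! j" for j
    by (simp_all add: f_def)
  have "pair_graph (T_shape a b k)"
    unfolding T_shape_def
  proof (rule pair_graph_sym_closure)
    show "irrefl (arm_arcs (Centre 0) 0 a \<union> arm_arcs (Centre 0) 1 b \<union> arm_arcs (Centre 0) 2 k)"
      using irrefl_arm_arcs unfolding irrefl_def by blast
  qed (use pos arm_arcs_subset in \<open>simp_all add: finite_arm_verts, blast\<close>)
  then have "digraph_iso (with_proj (T_shape a b k)) (with_proj (fork c xs ys zs))"
    unfolding fork_def
  proof (rule digraph_iso_mk_graph[OF _ T_shape_def, where f = f])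
    show "f ` ({Centre 0} \<union> arm_verts 0 a \<union> arm_verts 1 b \<union> arm_verts 2 k) = set (c # xs @ ys @ zs)"
      using image_arm_verts[OF f(2)] image_arm_verts[OF f(3)] image_arm_verts[OF f(4)]
      by (simp add: image_Un f(1) lengths Un_assoc)
    show "(\<lambda>(x, y). (f x, f y)) `
        (arm_arcs (Centre 0) 0 a \<union> arm_arcs (Centre 0) 1 b \<union> arm_arcs (Centre 0) 2 k) =
        steps (c # xs) \<union> steps (c # ys) \<union> steps (c # zs)"
      using image_arm_arcs[of f, OF f(2) assms(1)] image_arm_arcs[of f, OF f(3) assms(2)]
        image_arm_arcs[of f, OF f(4) assms(3)]
      by (simp add: image_Un f(1) lengths)
    have "card ({Centre 0} \<union> arm_verts 0 a \<union> arm_verts 1 b \<union> arm_verts 2 k) \<le> 1 + a + b + k"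
      using card_Un_le[of "{Centre 0} \<union> arm_verts 0 a \<union> arm_verts 1 b" "arm_verts 2 k"]
        card_Un_le[of "{Centre 0} \<union> arm_verts 0 a" "arm_verts 1 b"]
        card_Un_le[of "{Centre 0}" "arm_verts 0 a"]
      by (simp add: card_arm_verts)
    then show "card ({Centre 0} \<union> arm_verts 0 a \<union> arm_verts 1 b \<union> arm_verts 2 k)
        \<le> length (c # xs @ ys @ zs)"
      by (simp add: lengths)
  qed fact
  then show ?thesis using pos unfolding is_T_shape_def by blast
qed

lemma is_H_shape_twin_fork:
  assumes "xs \<noteq> []" and "ys \<noteq> []" and "zs \<noteq> []" and "ws \<noteq> []"
    and "distinct (c # d # xs @ ys @ zs @ ws)"
  shows "is_H_shape (twin_fork c xs ys d zs ws)"
proof -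
  define k l m n where lengths: "k = length xs" "l = length ys" "m = length zs" "n = length ws"
  have pos: "1 \<le> k" "1 \<le> l" "1 \<le> m" "1 \<le> n"
    using assms by (simp_all add: lengths Suc_le_eq)
  define f where "f v = (case v of Centre i \<Rightarrow> if i = 0 then c else d
    | Arm i j \<Rightarrow> (if i = 0 then xs else if i = 1 then ys else if i = 2 then zs else ws) ! j)" for v
  have f: "f (Centre 0) = c" "f (Centre 1) = d" "f (Arm 0 j) = xs ! j" "f (Arm 1 j) = ys ! j"
      "f (Arm 2 j) = zs ! j" "f (Arm 3 j) = ws ! j" for j
    by (simp_all add: f_def)
  let ?V = "{Centre 0, Centre 1} \<union> arm_verts 0 k \<union> arm_verts 1 l \<union> arm_verts 2 m \<union> arm_verts 3 n"
  let ?R = "{(Centre 0, Centre 1)} \<union> arm_arcs (Centre 0) 0 k \<union> arm_arcs (Centre 0) 1 l \<union>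
    arm_arcs (Centre 1) 2 m \<union> arm_arcs (Centre 1) 3 n"
  have "pair_graph (H_shape k l m n)"
    unfolding H_shape_def
  proof (rule pair_graph_sym_closure)
    show "irrefl ?R"
      using irrefl_arm_arcs unfolding irrefl_def by auto
    show "?R \<subseteq> ?V \<times> ?V"
      using pos arm_arcs_subset[of k "Centre 0" 0] arm_arcs_subset[of l "Centre 0" 1]
        arm_arcs_subset[of m "Centre 1" 2] arm_arcs_subset[of n "Centre 1" 3] by simp blast
  qed (simp add: finite_arm_verts)
  then have "digraph_iso (with_proj (H_shape k l m n)) (with_proj (twin_fork c xs ys d zs ws))"
    unfolding twin_fork_def
  proof (rule digraph_iso_mk_graph[OF _ H_shape_def, where f = f])
    show "f ` ?V = set (c # d # xs @ ys @ zs @ ws)"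
      using image_arm_verts[OF f(3)] image_arm_verts[OF f(4)] image_arm_verts[OF f(5)]
        image_arm_verts[OF f(6)]
      by (simp add: image_Un f(1) f(2)[simplified] lengths Un_assoc)
    show "(\<lambda>(x, y). (f x, f y)) ` ?R =
        {(c, d)} \<union> steps (c # xs) \<union> steps (c # ys) \<union> steps (d # zs) \<union> steps (d # ws)"
      using image_arm_arcs[of f, OF f(3) assms(1), of "Centre 0"]
        image_arm_arcs[of f, OF f(4) assms(2), of "Centre 0"]
        image_arm_arcs[of f, OF f(5) assms(3), of "Centre 1"]
        image_arm_arcs[of f, OF f(6) assms(4), of "Centre 1"]
      by (simp add: image_Un f(1) f(2)[simplified] lengths)
    have "card {Centre 0, Centre 1} \<le> 2" by (simp add: card_insert_if)
    then have "card ?V \<le> 2 + k + l + m + n"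
      using card_Un_le[of "{Centre 0, Centre 1} \<union> arm_verts 0 k \<union> arm_verts 1 l \<union> arm_verts 2 m" "arm_verts 3 n"]
        card_Un_le[of "{Centre 0, Centre 1} \<union> arm_verts 0 k \<union> arm_verts 1 l" "arm_verts 2 m"]
        card_Un_le[of "{Centre 0, Centre 1} \<union> arm_verts 0 k" "arm_verts 1 l"]
        card_Un_le[of "{Centre 0, Centre 1}" "arm_verts 0 k"]
      unfolding card_arm_verts by linarith
    then show "card ?V \<le> length (c # d # xs @ ys @ zs @ ws)"
      by (simp add: lengths)
  qed fact
  then show ?thesis using pos unfolding is_H_shape_def by blast
qed

lemma list_shape_in_family: "list_shape G \<Longrightarrow> G \<in> path_T_H_family"
  unfolding path_T_H_family_def mem_Collect_eq
  by (induction rule: list_shape.induct)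
    (simp_all only: is_path_line is_T_shape_fork is_H_shape_twin_fork simp_thms)

section \<open>Every tree has a standard shape or is crowded\<close>

context tree_graph
begin

lemma induced_pverts: "induced T (pverts T) = T"
  by (intro graph_eqI) (auto dest: in_arcsD1 in_arcsD2)

lemma crowded_induced_imp_crowded:
  assumes "crowded (induced T S)" and "S \<subseteq> pverts T"
  shows "crowded T"
proof -
  have "card (neighbourhood (induced T S) v) \<le> card (neighbourhood T v)" for v
  proof (rule card_mono)
    show "finite (neighbourhood T v)"
      by (rule finite_subset[OF _ pair_finite_verts]) (auto simp: neighbourhood_def dest: in_arcsD2)
  qed (auto simp: neighbourhood_def)
  then have "k \<le> card (neighbourhood T v)" if "k \<le> card (neighbourhood (induced T S) v)" for k v
    using that le_trans by blast
  moreover have "(u, v) \<in> parcs (induced T S)" if "(u, v) \<in> parcs T" "u \<in> S" "v \<in> S" for u v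
    using that by simp
  ultimately show ?thesis
    using assms unfolding crowded_def induced_simps(1) by blast
qed

text \<open>
  The tree is grown from a single vertex. Every new leaf either keeps the part built so far in
  one of the three shapes or makes it crowded, and then the whole tree is crowded as well,
  since degrees only increase and nonadjacent vertices stay nonadjacent.
\<close>

lemma list_shape_or_crowded: "list_shape T \<or> crowded T"
proof -
  obtain r where r: "r \<in> pverts T" using pverts_nonempty by blast
  have "list_shape (induced T (pverts T)) \<or> crowded T"
  proof (rule connected_set_grow[where A = "{r}" and B = "pverts T"
        and P = "\<lambda>S. list_shape (induced T S) \<or> crowded T"])
    have "induced T {r} = line [r]"
      by (intro graph_eqI) (auto simp: line_def sym_closure_def)
    then show "list_shape (induced T {r}) \<or> crowded T"
      by (simp add: list_shape.line)
  next
    fix S x y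
    assume S: "connected_set S" "S \<subseteq> pverts T" "x \<in> pverts T" "x \<notin> S" "y \<in> S" "(x, y) \<in> parcs T"
      and IH: "list_shape (induced T S) \<or> crowded T"
    have x_arcs: "(x, z) \<in> parcs T \<longleftrightarrow> z = y" "(z, x) \<in> parcs T \<longleftrightarrow> z = y" if "z \<in> S" for z
      using that S unique_neighbour_in_connected_set[of S x z y] arc_sym[of z x] by auto
    have "induced T (insert x S) = add_leaf (induced T S) y x"
      using S(4,5) by (intro graph_eqI) (auto simp: add_leaf_def x_arcs)
    moreover have "insert x S \<subseteq> pverts T" using S by simp
    ultimately show "list_shape (induced T (insert x S)) \<or> crowded T"
      using IH list_shape_add_leaf[of "induced T S" y x] S(4,5)
        crowded_induced_imp_crowded[of "insert x S"] by auto
  qed (use r connected_set_pverts connected_set_singleton in auto)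
  then show ?thesis by (simp add: induced_pverts)
qed

lemma crowded_imp_isolates:
  assumes "crowded T"
  shows "isolates 3 T"
  using assms unfolding crowded_def
proof (elim disjE bexE conjE)
  fix c assume c: "c \<in> pverts T" and degree: "4 \<le> card (neighbourhood T c)"
  obtain A where A: "A \<subseteq> neighbourhood T c" "card A = 4" "finite A"
    by (rule obtain_subset_with_card_n[OF degree])
  moreover have "neighbourhood T c \<subseteq> pverts T"
    by (auto simp: neighbourhood_def dest: in_arcsD2)
  ultimately have "isolates 3 (induced T (pverts T))"
    by (intro isolates_star[OF connected_set_pverts c A(3)]) auto
  then show ?thesis by (simp add: induced_pverts)
next
  fix u v
  assume "u \<in> pverts T" "v \<in> pverts T" "u \<noteq> v" "(u, v) \<notin> parcs T"
    "3 \<le> card (neighbourhood T u)" "3 \<le> card (neighbourhood T v)"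
  then show ?thesis by (rule isolates_two_nonadjacent_branch_verts)
qed

end

theorem theorem15:
  fixes T :: "'a pair_pre_digraph" and n :: nat
  assumes "undirected_tree T"
    and "card (pverts T) = n"
    and "T \<notin> path_T_H_family"
  shows "\<exists>L \<subseteq> pverts T. \<exists>T' L'. lc_minor (T, L) (T', L') \<and>
           card (isolated_verts T') \<ge> 3 \<and> isolated_verts T' \<inter> L' = {}"
proof -
  interpret tree_graph T using assms(1) by unfold_locales
  have "isolates 3 T"
    using list_shape_or_crowded list_shape_in_family[of T] assms(3) crowded_imp_isolates by blast
  then show ?thesis
    by (rule isolates_imp_lc_minor[OF _ pair_graph_axioms])
qed

end
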